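(* Let $D$ be a finite group, consider $\Z\wr D$ with generating set $S_D=\{t\}\cup\{\delta_i : i\in D\setminus\{\mathrm{Id}_D\}\}$, and for $n\ge 1$ let $F_n=\{(k,f): k\in\{1,\dots,n\},\ \mathrm{supp}(f)\subset\{1,\dots,n\}\}$. (1) For every $n\geq 2(|D|-1)$ and every finite nonempty $F\subset\Z\wr D$ with $|F|\leq|F_n|$, $$\frac{|\partial_{edge}F|}{|F|}\geq\frac{|\partial_{out}F|}{|F|}\geq\frac{|\partial_{out}F_n|}{|F_n|}=\frac{|\partial_{edge}F_n|}{|F_n|},$$ and if $|F|<|F_n|$ then $\frac{|\partial_{out}F|}{|F|}>\frac{|\partial_{out}F_n|}{|F_n|}$. (2) For every $n\geq 2(|D|-1)$ and every finite nonempty $F\subset\Z\wr D$ with $|F|\leq|F_n\cup\partial_{out}F_n|$, $$\frac{|\partial_{in}F|}{|F|}\geq\frac{|\partial_{in}(F_n\cup\partial_{out}F_n)|}{|F_n\cup\partial_{out}F_n|},$$ and the inequality is strict if $|F|<|F_n\cup\partial_{out}F_n|$. (Note $F_n\cup\partial_{out}F_n=\{(k,f):k\in\{0,\dots,n+1\},\ \mathrm{supp}(f)\subset\{1,\dots,n\}\}$.) Furthermore, the sets attaining equality in (1) (for the outer boundary), respectively in (2), are unique up to translation: they are left translates $gF_n$, respectively $g(F_n\cup\partial_{out}F_n)$, $g\in\Z\wr D$.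
   Context: $\Z\wr D$ is the set of pairs $(k,f)$, $k\in\Z$, $f:\Z\to D$ finitely supported ($\mathrm{supp}(f)=\{x:f(x)\neq\mathrm{Id}_D\}$), with product $(a,f)(a',f')=(a+a',x\mapsto f(x)f'(x-a))$. $t=(1,\mathbb{1})$ with $\mathbb{1}\equiv\mathrm{Id}_D$; $\delta_i=(0,\delta_0^i)$ with $\delta_0^i(0)=i$ and $\delta_0^i(x)=\mathrm{Id}_D$ for $x\neq0$. For a group $G$ with finite generating set $S$ and finite $F\subset G$: the inner boundary is $\partial_{in}F=\{g\in F:\exists s\in S\cup S^{-1}, gs\notin F\}$; the outer boundary is $\partial_{out}F=\{gs: g\in F, s\in S\cup S^{-1}\}\setminus F$ (vertices at distance exactly $1$ from $F$ in the Cayley graph); the edge boundary $\partial_{edge}F$ is the set of edges of the Cayley graph (vertices $G$, $g$ adjacent to $gs$ for $s\in S\cup S^{-1}$) joining a vertex of $F$ to a vertex outside $F$. *)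

theory Defs
  imports Complex_Main "HOL-Algebra.Group"
begin

definition supp :: "('a, 'b) monoid_scheme \<Rightarrow> (int \<Rightarrow> 'a) \<Rightarrow> int set" where
  "supp D f = {x. f x \<noteq> \<one>\<^bsub>D\<^esub>}"

definition wr_carrier :: "('a, 'b) monoid_scheme \<Rightarrow> (int \<times> (int \<Rightarrow> 'a)) set" where
  "wr_carrier D = {(k, f). (\<forall>x. f x \<in> carrier D) \<and> finite (supp D f)}"

definition wr_mult :: "('a, 'b) monoid_scheme \<Rightarrow> int \<times> (int \<Rightarrow> 'a) \<Rightarrow> int \<times> (int \<Rightarrow> 'a)
    \<Rightarrow> int \<times> (int \<Rightarrow> 'a)" where
  "wr_mult D g h = (fst g + fst h, \<lambda>x. snd g x \<otimes>\<^bsub>D\<^esub> snd h (x - fst g))"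

definition wr_inv :: "('a, 'b) monoid_scheme \<Rightarrow> int \<times> (int \<Rightarrow> 'a) \<Rightarrow> int \<times> (int \<Rightarrow> 'a)" where
  "wr_inv D g = (- fst g, \<lambda>x. inv\<^bsub>D\<^esub> (snd g (x + fst g)))"

definition wr_t :: "('a, 'b) monoid_scheme \<Rightarrow> int \<times> (int \<Rightarrow> 'a)" where
  "wr_t D = (1, \<lambda>_. \<one>\<^bsub>D\<^esub>)"

definition wr_delta :: "('a, 'b) monoid_scheme \<Rightarrow> 'a \<Rightarrow> int \<times> (int \<Rightarrow> 'a)" where
  "wr_delta D i = (0, (\<lambda>_. \<one>\<^bsub>D\<^esub>)(0 := i))"

definition wr_gens :: "('a, 'b) monoid_scheme \<Rightarrow> (int \<times> (int \<Rightarrow> 'a)) set" where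
  "wr_gens D = insert (wr_t D) (wr_delta D ` (carrier D - {\<one>\<^bsub>D\<^esub>}))"

definition wr_sgens :: "('a, 'b) monoid_scheme \<Rightarrow> (int \<times> (int \<Rightarrow> 'a)) set" where
  "wr_sgens D = wr_gens D \<union> wr_inv D ` wr_gens D"

definition inner_boundary :: "('a, 'b) monoid_scheme \<Rightarrow> (int \<times> (int \<Rightarrow> 'a)) set
    \<Rightarrow> (int \<times> (int \<Rightarrow> 'a)) set" where
  "inner_boundary D F = {g \<in> F. \<exists>s \<in> wr_sgens D. wr_mult D g s \<notin> F}"

definition outer_boundary :: "('a, 'b) monoid_scheme \<Rightarrow> (int \<times> (int \<Rightarrow> 'a)) set
    \<Rightarrow> (int \<times> (int \<Rightarrow> 'a)) set" where
  "outer_boundary D F = {wr_mult D g s | g s. g \<in> F \<and> s \<in> wr_sgens D} - F"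

text \<open>Edges of the (undirected) Cayley graph are represented as two-element sets {g, gs}.\<close>
definition edge_boundary :: "('a, 'b) monoid_scheme \<Rightarrow> (int \<times> (int \<Rightarrow> 'a)) set
    \<Rightarrow> (int \<times> (int \<Rightarrow> 'a)) set set" where
  "edge_boundary D F = {{g, wr_mult D g s} | g s. g \<in> F \<and> s \<in> wr_sgens D \<and> wr_mult D g s \<notin> F}"

definition Fn :: "('a, 'b) monoid_scheme \<Rightarrow> nat \<Rightarrow> (int \<times> (int \<Rightarrow> 'a)) set" where
  "Fn D n = {(k, f) \<in> wr_carrier D. k \<in> {1..int n} \<and> supp D f \<subseteq> {1..int n}}"

end

theory Submission
  imports Defs "HOL-Library.FuncSet"
begin

text \<open>
  Let \<open>d\<close> be the order of the lamp group, \<open>A\<close> the set of the \<open>N\<close> lamp configurations occurring in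
  \<open>F\<close>, and \<open>B\<close> the number of outer boundary points whose configuration is not in \<open>A\<close>. Both ends of
  every line of \<open>F\<close> in direction \<open>t\<close> give boundary points, so the outer boundary has at least
  \<open>2 N + B\<close> elements. A point \<open>(k, f)\<close> of \<open>F\<close> either has all \<open>f(k := y)\<close> in \<open>A\<close>, or it is a
  neighbour of one of the \<open>B\<close> extra boundary points, each of which has only \<open>d - 1\<close> such neighbours.
  An entropy argument bounds the number of pairs \<open>(k, f)\<close> of the first kind by \<open>N log\<^sub>d N\<close>, with
  equality only if \<open>A\<close> is a subcube. If the boundary has at most \<open>2 d^n\<close> elements, then \<open>N \<le> d^n\<close>,
  and \<open>2 (d - 1) \<le> n\<close> gives \<open>|F| \<le> n N + (d - 1) B \<le> (n / 2) (2 N + B)\<close>. For the inner boundary,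
  apply this to \<open>F\<close> minus its inner boundary, whose outer boundary lies in the inner boundary of \<open>F\<close>.
\<close>

section \<open>Full directions in sets of configurations\<close>

text \<open>With \<open>s = sum a C\<close>, the right side minus the first sum is the sum of
  \<open>a x * (ln s - ln (a x))\<close>. Since \<open>a x < s\<close>, each bracket is positive
  wherever \<open>a x > 0\<close>, so lowering \<open>a x\<close> to \<open>m\<close> only loses,
  and loses strictly unless \<open>a x = m\<close>. What remains is \<open>m\<close> times a sum of
  \<open>ln (s / a x)\<close>, which concavity of the logarithm bounds below by
  \<open>d ln d\<close>, with \<open>d = card C\<close>.\<close>

lemma entropy_bound:
  fixes a :: "'a \<Rightarrow> real" and m :: real
  assumes fin: "finite C" and m: "0 \<le> m" "\<And>x. x \<in> C \<Longrightarrow> m \<le> a x"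
    and lt: "\<And>x. x \<in> C \<Longrightarrow> a x < sum a C" and ne: "C \<noteq> {}"
  shows "(\<Sum>x\<in>C. a x * ln (a x)) + card C * m * ln (card C) \<le> sum a C * ln (sum a C)"
    and "(\<Sum>x\<in>C. a x * ln (a x)) + card C * m * ln (card C) = sum a C * ln (sum a C)
           \<Longrightarrow> x \<in> C \<Longrightarrow> a x = m"
proof -
  define s where "s = sum a C"
  define d where "d = real (card C)"
  have d0: "d > 0" using fin ne by (simp add: d_def card_gt_0_iff)
  obtain x0 where "x0 \<in> C" using ne by auto
  then have s0: "s > 0" using m(1) m(2)[of x0] lt[of x0] by (simp add: s_def)
  \<comment> \<open>The case \<open>a x = m\<close> is split off because it absorbs
    \<open>a x = 0\<close>; no property of \<open>ln 0\<close> enters.\<close>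
  have le: "m * (ln s - ln (a x)) \<le> a x * (ln s - ln (a x))" if "x \<in> C" for x
  proof (cases "a x = m")
    case False
    then have "a x > m" using m(2)[OF that] by simp
    moreover have "ln (a x) < ln s" using lt[OF that] \<open>a x > m\<close> m(1) by (simp add: s_def)
    ultimately show ?thesis by (intro mult_right_mono) auto
  qed auto
  have lt': "m * (ln s - ln (a x)) < a x * (ln s - ln (a x))" if "x \<in> C" "a x \<noteq> m" for x
  proof -
    have "a x > m" using m(2)[OF that(1)] that by simp
    moreover have "ln (a x) < ln s" using lt[OF that(1)] \<open>a x > m\<close> m(1) by (simp add: s_def)
    ultimately show ?thesis by (intro mult_strict_right_mono) auto
  qed
  \<comment> \<open>From \<open>ln u \<le> u - 1\<close> at \<open>u = d a(x) / s\<close>, summed over \<open>x\<close>.\<close>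
  have amgm: "d * m * ln d \<le> (\<Sum>x\<in>C. m * (ln s - ln (a x)))"
  proof (cases "m = 0")
    case False
    then have pos: "a x > 0" if "x \<in> C" for x using m(1) m(2)[OF that] by simp
    have "(\<Sum>x\<in>C. ln d - (ln s - ln (a x))) \<le> (\<Sum>x\<in>C. d * a x / s - 1)"
    proof (rule sum_mono)
      fix x assume x: "x \<in> C"
      have "ln (d * a x / s) \<le> d * a x / s - 1"
        using d0 s0 pos[OF x] by (intro ln_le_minus_one) auto
      moreover have "ln (d * a x / s) = ln d + ln (a x) - ln s"
        using d0 s0 pos[OF x] by (simp add: ln_div ln_mult)
      ultimately show "ln d - (ln s - ln (a x)) \<le> d * a x / s - 1" by simp
    qed
    also have "\<dots> = d * s / s - d"
      by (simp add: sum_subtractf s_def sum_divide_distrib sum_distrib_left d_def)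
    also have "\<dots> = 0" using s0 by simp
    finally have "d * ln d \<le> (\<Sum>x\<in>C. ln s - ln (a x))" by (simp add: sum_subtractf d_def)
    then have "m * (d * ln d) \<le> m * (\<Sum>x\<in>C. ln s - ln (a x))"
      using m(1) by (intro mult_left_mono)
    then show ?thesis by (simp add: sum_distrib_left ac_simps)
  qed simp
  have eq: "(\<Sum>x\<in>C. a x * (ln s - ln (a x))) = s * ln s - (\<Sum>x\<in>C. a x * ln (a x))"
    by (simp add: right_diff_distrib sum_subtractf s_def sum_distrib_right)
  show "(\<Sum>x\<in>C. a x * ln (a x)) + card C * m * ln (card C) \<le> sum a C * ln (sum a C)"
    using amgm eq sum_mono[of C "\<lambda>x. m * (ln s - ln (a x))" "\<lambda>x. a x * (ln s - ln (a x))"] le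
    by (fastforce simp: s_def d_def)
  assume e: "(\<Sum>x\<in>C. a x * ln (a x)) + card C * m * ln (card C) = sum a C * ln (sum a C)"
    and x: "x \<in> C"
  show "a x = m"
  proof (rule ccontr)
    assume "a x \<noteq> m"
    then have "(\<Sum>x\<in>C. m * (ln s - ln (a x))) < (\<Sum>x\<in>C. a x * (ln s - ln (a x)))"
      using le lt' x fin by (intro sum_strict_mono_ex1) auto
    then show False using e amgm eq by (simp add: s_def d_def)
  qed
qed

definition subcube :: "'a set \<Rightarrow> 'i set \<Rightarrow> ('i \<Rightarrow> 'a) \<Rightarrow> ('i \<Rightarrow> 'a) set" where
  "subcube C J f0 = {f. (\<forall>x\<in>J. f x \<in> C) \<and> (\<forall>x. x \<notin> J \<longrightarrow> f x = f0 x)}"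

text \<open>The pairs have the shape of group elements (position, configuration), so for
  configurations over the integers this set can be intersected directly with a subset of the wreath
  product.\<close>

definition full_dirs :: "'a set \<Rightarrow> ('i \<Rightarrow> 'a) set \<Rightarrow> ('i \<times> ('i \<Rightarrow> 'a)) set" where
  "full_dirs C A = {(k, f). f \<in> A \<and> (\<forall>y\<in>C. f(k := y) \<in> A)}"

lemma bij_betw_subcube_PiE:
  "bij_betw (\<lambda>f. restrict f J) (subcube C J f0) (J \<rightarrow>\<^sub>E C)"
  by (rule bij_betw_byWitness[where f' = "\<lambda>g x. if x \<in> J then g x else f0 x"])
    (auto simp: subcube_def fun_eq_iff PiE_def extensional_def)

lemma card_subcube:
  assumes "finite J"
  shows "card (subcube C J f0) = card C ^ card J"
  using bij_betw_same_card[OF bij_betw_subcube_PiE] assms by (metis card_funcsetE)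

lemma finite_subcube:
  assumes "finite J" "finite C"
  shows "finite (subcube C J f0)"
  using bij_betw_finite[OF bij_betw_subcube_PiE] assms by (metis finite_PiE)

text \<open>The index type may be infinite, so finiteness comes from recovering \<open>k\<close>: a
  second lamp value at \<open>k\<close> gives another member of \<open>A\<close>, and the two
  configurations differ exactly at \<open>k\<close>.\<close>

lemma finite_full_dirs:
  fixes A :: "('i \<Rightarrow> 'a) set"
  assumes "finite A" "finite C" "card C \<ge> 2"
  shows "finite (full_dirs C A)"
proof -
  have ex: "\<exists>y\<in>C. y \<noteq> z" for z
  proof (rule ccontr)
    assume "\<not> ?thesis"
    then have "C \<subseteq> {z}" by auto
    from card_mono[OF _ this] assms(3) show False by simp
  qed
  define h where "h = (\<lambda>(k::'i, f::'i \<Rightarrow> 'a). (f, f(k := (SOME y. y \<in> C \<and> y \<noteq> f k))))"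
  have some: "(SOME y. y \<in> C \<and> y \<noteq> z) \<in> C \<and> (SOME y. y \<in> C \<and> y \<noteq> z) \<noteq> z" for z
    by (rule someI_ex) (use ex[of z] in auto)
  have "inj_on h (full_dirs C A)"
  proof (rule inj_onI, clarify)
    fix k f k' f'
    assume "h (k, f) = h (k', f')"
    then have 1: "f = f'" and 2: "f(k := (SOME y. y \<in> C \<and> y \<noteq> f k)) = f(k' := (SOME y. y \<in> C \<and> y \<noteq> f k'))"
      by (auto simp: h_def)
    have "k = k'"
    proof (rule ccontr)
      assume "k \<noteq> k'"
      then have "(SOME y. y \<in> C \<and> y \<noteq> f k) = f k" using fun_cong[OF 2, of k] by simp
      then show False using some[of "f k"] by simp
    qed
    then show "k = k' \<and> f = f'" using 1 by simp
  qed
  moreover have "h ` full_dirs C A \<subseteq> A \<times> A"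
    using some by (auto simp: h_def full_dirs_def)
  ultimately show ?thesis using assms(1) by (meson finite_SigmaI finite_subset inj_on_finite)
qed

text \<open>For two lamp values this is the edge-isoperimetric inequality of the discrete cube. The
  induction on \<open>card A\<close> carries the equality case along, because the shape of
  \<open>A\<close> is read off from the shape of one slice. Products with \<open>ln\<close> stand in
  for logarithms to base \<open>card C\<close>.\<close>

lemma card_full_dirs_le:
  fixes A :: "('i \<Rightarrow> 'a) set"
  assumes C: "finite C" "card C \<ge> 2"
    and "finite A" "A \<noteq> {}" "\<And>f k. f \<in> A \<Longrightarrow> f k \<in> C"
  shows "card (full_dirs C A) * ln (card C) \<le> card A * ln (card A) \<and>
    (card (full_dirs C A) * ln (card C) = card A * ln (card A) \<longrightarrow>
      (\<exists>J f0. finite J \<and> A = subcube C J f0))"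
  using assms(3-)
proof (induction "card A" arbitrary: A rule: less_induct)
  case less
  show ?case
  proof (cases "\<exists>k. \<exists>f\<in>A. \<exists>g\<in>A. f k \<noteq> g k")
    \<comment> \<open>A single configuration has no full direction, as \<open>C\<close> has two
      values; both sides are 0 and \<open>A\<close> is the subcube with no free coordinate.\<close>
    case False
    then obtain f0 where A: "A = {f0}" using less.prems(2) by (metis ext is_singletonI' is_singleton_def)
    have "\<not> (\<forall>y\<in>C. f0(k := y) = f0)" for k
    proof
      assume "\<forall>y\<in>C. f0(k := y) = f0"
      then have "C \<subseteq> {f0 k}" by (metis fun_upd_same singletonI subsetI)
      from card_mono[OF _ this] C(2) show False by simp
    qed
    then have "full_dirs C A = {}" using A by (auto simp: full_dirs_def)
    moreover have "A = subcube C {} f0" using A by (auto simp: subcube_def)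
    moreover have "card A = 1" using A by simp
    ultimately show ?thesis by (simp del: fun_upd_apply) (metis finite.emptyI)
  next
    case True
    then obtain k f1 f2 where k: "f1 \<in> A" "f2 \<in> A" "f1 k \<noteq> f2 k" by auto
    \<comment> \<open>Slice \<open>A\<close> along a coordinate \<open>k\<close> on which it is not constant: full directions other than \<open>k\<close>
      stay inside a slice, and at most \<open>m\<close> full lines in direction \<open>k\<close> pass through the smallest slice.\<close>
    define B where "B = (\<lambda>x. {f\<in>A. f k = x})"
    define T where "T = {f\<in>A. \<forall>y\<in>C. f(k := y) \<in> A}"
    define a where "a = (\<lambda>x. card (B x))"
    define m where "m = Min (a ` C)"
    have Cne: "C \<noteq> {}" using C by auto
    have finB: "finite (B x)" for x using less.prems(1) by (simp add: B_def)
    have AB: "A = (\<Union>x\<in>C. B x)" using less.prems(3) by (auto simp: B_def)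
    have cA: "card A = (\<Sum>x\<in>C. a x)"
      unfolding a_def by (subst AB, subst card_UN_disjoint) (use C finB in \<open>auto simp: B_def\<close>)
    \<comment> \<open>Non-constancy at \<open>k\<close> makes every slice proper, which feeds both
      the induction and the strict hypothesis \<open>a x < sum a C\<close> of
      \<open>entropy_bound\<close>.\<close>
    have Bpsub: "B x \<subset> A" for x
    proof
      show "B x \<subseteq> A" by (auto simp: B_def)
      have "f1 \<notin> B x \<or> f2 \<notin> B x" using k by (auto simp: B_def)
      then show "B x \<noteq> A" using k by auto
    qed
    have alt: "a x < card A" for x
      unfolding a_def using psubset_card_mono[OF less.prems(1) Bpsub] .
    have ma: "m \<le> a x" if "x \<in> C" for x using that C by (simp add: m_def)
    have "m \<in> a ` C" unfolding m_def using C Cne by (intro Min_in) auto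
    then obtain x1 where x1: "x1 \<in> C" "a x1 = m" by auto
    \<comment> \<open>A full line in direction \<open>k\<close> meets the smallest slice
      \<open>B x1\<close> in exactly one configuration, so a member of \<open>T\<close> is
      determined by that configuration and its own value at \<open>k\<close>.\<close>
    have cT: "card T \<le> card C * m"
    proof -
      have inj: "inj_on (\<lambda>f. (f k, f(k := x1))) T"
        by (rule inj_onI) (metis fun_upd_triv fun_upd_upd prod.inject)
      have "(\<lambda>f. (f k, f(k := x1))) ` T \<subseteq> C \<times> B x1"
        using x1 less.prems(3) by (auto simp: T_def B_def)
      from card_inj_on_le[OF inj this] show ?thesis
        using C finB x1 by (simp add: card_cartesian_product a_def)
    qed
    have sub: "full_dirs C A \<subseteq> (\<Union>x\<in>C. full_dirs C (B x)) \<union> {k} \<times> T"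
    proof
      fix p assume p: "p \<in> full_dirs C A"
      obtain j f where jf: "p = (j, f)" by fastforce
      then have f: "f \<in> A" "\<forall>y\<in>C. f(j := y) \<in> A" using p by (auto simp: full_dirs_def)
      show "p \<in> (\<Union>x\<in>C. full_dirs C (B x)) \<union> {k} \<times> T"
      proof (cases "j = k")
        case False
        then have "p \<in> full_dirs C (B (f k))" using jf f by (auto simp: full_dirs_def B_def)
        then show ?thesis using f less.prems(3) by auto
      qed (use jf f in \<open>auto simp: T_def\<close>)
    qed
    have finF: "finite (full_dirs C (B x))" for x using finite_full_dirs finB C by blast
    have finT: "finite T" using less.prems(1) by (simp add: T_def)
    have "card (full_dirs C A) \<le> card ((\<Union>x\<in>C. full_dirs C (B x)) \<union> {k} \<times> T)"
      by (rule card_mono) (use sub finF finT C in auto)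
    also have "\<dots> \<le> card (\<Union>x\<in>C. full_dirs C (B x)) + card ({k} \<times> T)"
      by (rule card_Un_le)
    also have "\<dots> \<le> (\<Sum>x\<in>C. card (full_dirs C (B x))) + card T"
      using card_UN_le[OF C(1)] by (simp add: card_cartesian_product_singleton)
    finally have le1: "card (full_dirs C A) \<le> (\<Sum>x\<in>C. card (full_dirs C (B x))) + card T" .
    \<comment> \<open>Slices may be empty, in which case \<open>m = 0\<close>; the induction
      hypothesis covers only the nonempty ones.\<close>
    have IH: "card (full_dirs C (B x)) * ln (card C) \<le> a x * ln (a x)" for x
    proof (cases "B x = {}")
      case True then show ?thesis by (simp add: full_dirs_def a_def)
    next
      case False
      then show ?thesis using less.hyps[of "B x"] alt[of x] finB[of x] less.prems(3)
        unfolding a_def by (auto simp: B_def)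
    qed
    have lnC: "ln (card C) > 0" using C by simp
    have S: "(\<Sum>x\<in>C. real (card (full_dirs C (B x)))) * ln (card C) \<le> (\<Sum>x\<in>C. a x * ln (a x))"
      unfolding sum_distrib_right by (rule sum_mono) (rule IH)
    have sa: "(\<Sum>x\<in>C. real (a x)) = card A" using cA by simp
    have ent: "(\<Sum>x\<in>C. a x * ln (a x)) + card C * m * ln (card C) \<le> card A * ln (card A)"
      using entropy_bound(1)[of C "real m" "\<lambda>x. real (a x)"] C Cne ma alt unfolding sa by auto
    have ent': "a x = m" if "(\<Sum>x\<in>C. a x * ln (a x)) + card C * m * ln (card C) = card A * ln (card A)"
      "x \<in> C" for x
      using entropy_bound(2)[of C "real m" "\<lambda>x. real (a x)" x] C Cne ma alt that unfolding sa by auto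
    have le2: "card (full_dirs C A) * ln (card C)
        \<le> (\<Sum>x\<in>C. real (card (full_dirs C (B x)))) * ln (card C) + card T * ln (card C)"
    proof -
      have "real (card (full_dirs C A)) \<le> (\<Sum>x\<in>C. real (card (full_dirs C (B x)))) + card T"
        using le1 by (metis of_nat_add of_nat_le_iff of_nat_sum)
      then show ?thesis using lnC by (metis distrib_right less_imp_le mult_right_mono)
    qed
    have cT': "card T * ln (card C) \<le> card C * m * ln (card C)"
      using cT lnC by (metis less_imp_le mult_right_mono of_nat_le_iff of_nat_mult)
    show ?thesis
    proof (intro conjI impI)
      show "card (full_dirs C A) * ln (card C) \<le> card A * ln (card A)"
        using le2 cT' S ent by linarith
      assume eq: "card (full_dirs C A) * ln (card C) = card A * ln (card A)"
      have am: "a x = m" if "x \<in> C" for x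
        using ent'[OF _ that] eq le2 cT' S ent by linarith
      have "card T * ln (card C) = card C * m * ln (card C)"
        using eq le2 cT' S ent by linarith
      then have "real (card T) = real (card C * m)" using lnC by simp
      then have "card T = card C * m" by linarith
      then have "card T = card A" using cA am by simp
      \<comment> \<open>Equality puts every member of \<open>A\<close> on a full line in direction
        \<open>k\<close>. Hence \<open>A\<close> is the slice \<open>B x1\<close> with coordinate
        \<open>k\<close> set free, and it suffices to identify this one slice.\<close>
      then have T: "T = A" using card_subset_eq[OF less.prems(1), of T] by (auto simp: T_def)
      have sums: "(\<Sum>x\<in>C. real (card (full_dirs C (B x))) * ln (card C)) = (\<Sum>x\<in>C. a x * ln (a x))"
        using eq le2 cT' S ent by (simp add: sum_distrib_right)
      \<comment> \<open>The slice inequalities hold termwise and their sums agree, so each of them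
        is an equality.\<close>
      have eqx: "card (full_dirs C (B x1)) * ln (card C) = a x1 * ln (a x1)"
        using sum_mono_inv[OF sums IH x1(1) C(1)] by simp
      have "card A \<noteq> 0" using less.prems by simp
      then have "m \<noteq> 0" using cA am by auto
      then have Bne: "B x1 \<noteq> {}" using x1 by (auto simp: a_def)
      obtain J f0 where J: "finite J" "B x1 = subcube C J f0"
        using less.hyps[of "B x1"] alt[of x1] finB[of x1] less.prems(3) Bne eqx
        unfolding a_def by (fastforce simp: B_def)
      have inv: "f(k := y) \<in> A" if "f \<in> A" "y \<in> C" for f y using T that by (auto simp: T_def)
      have up: "f \<in> A \<longleftrightarrow> f(k := x1) \<in> B x1 \<and> f k \<in> C" for f
      proof
        assume "f(k := x1) \<in> B x1 \<and> f k \<in> C"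
        then show "f \<in> A" using inv[of "f(k := x1)" "f k"] by (simp add: B_def)
      qed (use inv x1 less.prems(3) in \<open>auto simp: B_def\<close>)
      \<comment> \<open>The slice is frozen at \<open>k\<close> with value \<open>x1\<close>, while
        a free coordinate would take at least two values.\<close>
      have kJ: "k \<notin> J"
      proof
        assume "k \<in> J"
        obtain f where f: "f \<in> B x1" using Bne by auto
        have "f(k := y) \<in> B x1" if "y \<in> C" for y
          using f \<open>k \<in> J\<close> that unfolding J by (auto simp: subcube_def)
        then have "C \<subseteq> {x1}" by (auto simp: B_def)
        from card_mono[OF _ this] C(2) show False by simp
      qed
      have f0k: "f0 k = x1"
      proof -
        obtain f where f: "f \<in> B x1" using Bne by auto
        then have "f k = f0 k" unfolding J using kJ by (simp add: subcube_def)
        then show ?thesis using f by (simp add: B_def)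
      qed
      have "A = subcube C (insert k J) f0"
      proof (rule Set.set_eqI)
        fix f
        show "f \<in> A \<longleftrightarrow> f \<in> subcube C (insert k J) f0"
          unfolding up J subcube_def using kJ f0k by auto
      qed
      then show "\<exists>J f0. finite J \<and> A = subcube C J f0" using J(1) by blast
    qed
  qed
qed

section \<open>Boundaries in the wreath product\<close>

text \<open>Coordinate form of the translates \<open>p s\<close> by generators and their inverses:
  move the cursor, or change the lamp under it. \<open>wr_mult_sgens\<close> proves the agreement on
  the carrier, and most later boundary arguments use this form.\<close>

definition neighbours :: "('a, 'b) monoid_scheme \<Rightarrow> int \<times> (int \<Rightarrow> 'a) \<Rightarrow> (int \<times> (int \<Rightarrow> 'a)) set" where
  "neighbours D p = {(fst p + 1, snd p), (fst p - 1, snd p)}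
     \<union> (\<lambda>y. (fst p, (snd p)(fst p := y))) ` (carrier D - {snd p (fst p)})"

text \<open>One point per configuration: only the far end of each line counts, whatever gaps the
  line has.\<close>

definition upper_ends :: "(int \<times> 'c) set \<Rightarrow> (int \<times> 'c) set" where
  "upper_ends F = (\<lambda>f. (Max {k. (k, f) \<in> F} + 1, f)) ` snd ` F"

definition lower_ends :: "(int \<times> 'c) set \<Rightarrow> (int \<times> 'c) set" where
  "lower_ends F = (\<lambda>f. (Min {k. (k, f) \<in> F} - 1, f)) ` snd ` F"

lemma finite_line: "finite F \<Longrightarrow> finite {k. (k, f) \<in> F}"
  by (rule finite_subset[of _ "fst ` F"]) force+

lemma card_ends:
  fixes F :: "(int \<times> 'c) set"
  assumes "finite F"
  shows "card (lower_ends F \<union> upper_ends F) = 2 * card (snd ` F)"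
proof -
  have "Min {k. (k, f) \<in> F} - 1 < Max {k. (k, f) \<in> F} + 1" if "f \<in> snd ` F" for f
  proof -
    have "{k. (k, f) \<in> F} \<noteq> {}" using that by auto
    then have "Min {k. (k, f) \<in> F} \<le> Max {k. (k, f) \<in> F}"
      using finite_line[OF assms, of f] by (meson Max_ge Min_in)
    then show ?thesis by simp
  qed
  then have "lower_ends F \<inter> upper_ends F = {}"
    unfolding lower_ends_def upper_ends_def by fastforce
  moreover have "card (lower_ends F) = card (snd ` F)" "card (upper_ends F) = card (snd ` F)"
    unfolding lower_ends_def upper_ends_def by (auto intro!: card_image inj_onI)
  moreover have "finite (lower_ends F)" "finite (upper_ends F)"
    using assms by (auto simp: lower_ends_def upper_ends_def)
  ultimately show ?thesis by (simp add: card_Un_disjoint)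
qed

section \<open>The wreath product and its Cayley neighbours\<close>

locale finite_group = group D for D :: "('a, 'b) monoid_scheme" (structure) +
  assumes finite_carrier: "finite (carrier D)"
begin

lemma card_carrier_pos: "card (carrier D) > 0"
  using finite_carrier by (metis card_gt_0_iff empty_iff one_closed)

lemma wr_mult_closed:
  assumes "g \<in> wr_carrier D" "h \<in> wr_carrier D"
  shows "wr_mult D g h \<in> wr_carrier D"
proof -
  obtain a f b f' where gh: "g = (a, f)" "h = (b, f')" by fastforce
  have "supp D (\<lambda>x. f x \<otimes> f' (x - a)) \<subseteq> supp D f \<union> (\<lambda>x. x + a) ` supp D f'"
  proof
    fix x assume "x \<in> supp D (\<lambda>x. f x \<otimes> f' (x - a))"
    then have "f x \<noteq> \<one> \<or> f' (x - a) \<noteq> \<one>" by (auto simp: supp_def)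
    then show "x \<in> supp D f \<union> (\<lambda>x. x + a) ` supp D f'"
      by (auto simp: supp_def image_iff intro!: exI[of _ "x - a"])
  qed
  then have "finite (supp D (\<lambda>x. f x \<otimes> f' (x - a)))"
    using assms gh by (auto simp: wr_carrier_def intro: finite_subset)
  then show ?thesis using assms gh by (auto simp: wr_carrier_def wr_mult_def)
qed

lemma wr_mult_assoc:
  assumes "g \<in> wr_carrier D" "h \<in> wr_carrier D" "s \<in> wr_carrier D"
  shows "wr_mult D (wr_mult D g h) s = wr_mult D g (wr_mult D h s)"
  using assms by (auto simp: wr_mult_def wr_carrier_def fun_eq_iff m_assoc algebra_simps)

lemma inj_on_wr_mult:
  assumes "g \<in> wr_carrier D"
  shows "inj_on (wr_mult D g) (wr_carrier D)"
proof (rule inj_onI)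
  fix p q assume pq: "p \<in> wr_carrier D" "q \<in> wr_carrier D" "wr_mult D g p = wr_mult D g q"
  have "snd p x = snd q x" for x
  proof -
    have "snd g (x + fst g) \<otimes> snd p x = snd g (x + fst g) \<otimes> snd q x"
      using pq(3) by (auto simp: wr_mult_def dest!: fun_cong[of _ _ "x + fst g"])
    then show ?thesis using assms pq by (auto simp: wr_carrier_def)
  qed
  moreover have "fst p = fst q" using pq(3) by (simp add: wr_mult_def)
  ultimately show "p = q" by (simp add: prod_eq_iff fun_eq_iff)
qed

lemma wr_inv_delta: "i \<in> carrier D \<Longrightarrow> wr_inv D (wr_delta D i) = wr_delta D (inv i)"
  by (auto simp: wr_inv_def wr_delta_def fun_eq_iff)

lemma wr_sgens_eq:
  "wr_sgens D = {(1, \<lambda>_. \<one>), (-1, \<lambda>_. \<one>)} \<union> wr_delta D ` (carrier D - {\<one>})"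
proof -
  have "wr_inv D ` wr_delta D ` (carrier D - {\<one>}) \<subseteq> wr_delta D ` (carrier D - {\<one>})"
    by (auto simp: wr_inv_delta inv_eq_1_iff)
  then show ?thesis by (auto simp: wr_sgens_def wr_gens_def wr_t_def wr_inv_def)
qed

lemma wr_sgens_carrier: "wr_sgens D \<subseteq> wr_carrier D"
  by (auto simp: wr_sgens_eq wr_carrier_def wr_delta_def supp_def)

lemma finite_wr_sgens: "finite (wr_sgens D)"
  by (simp add: wr_sgens_eq finite_carrier)

text \<open>Right multiplication by a lamp generator replaces the lamp \<open>f k\<close> at the
  cursor by \<open>f k \<otimes> i\<close>, and left multiplication by \<open>f k\<close> maps the
  non-identity elements onto the elements other than \<open>f k\<close>.\<close>

lemma wr_mult_sgens:
  assumes "p \<in> wr_carrier D"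
  shows "wr_mult D p ` wr_sgens D = neighbours D p"
proof -
  obtain k f where p: "p = (k, f)" by fastforce
  have f: "f x \<in> carrier D" for x using assms p by (auto simp: wr_carrier_def)
  have 1: "wr_mult D p (a, \<lambda>_. \<one>) = (k + a, f)" for a
    using f by (auto simp: wr_mult_def p)
  have 2: "wr_mult D p (wr_delta D i) = (k, f(k := f k \<otimes> i))" for i
    using f by (auto simp: wr_mult_def wr_delta_def p fun_eq_iff)
  have "(\<lambda>i. f k \<otimes> i) ` (carrier D - {\<one>}) = carrier D - {f k}"
  proof
    show "(\<lambda>i. f k \<otimes> i) ` (carrier D - {\<one>}) \<subseteq> carrier D - {f k}"
      using f by auto
    show "carrier D - {f k} \<subseteq> (\<lambda>i. f k \<otimes> i) ` (carrier D - {\<one>})"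
    proof
      fix y assume y: "y \<in> carrier D - {f k}"
      have "y = f k \<otimes> (inv (f k) \<otimes> y)" using y f by (simp add: m_assoc[symmetric])
      moreover have "inv (f k) \<otimes> y \<noteq> \<one>" using y f calculation by auto
      ultimately show "y \<in> (\<lambda>i. f k \<otimes> i) ` (carrier D - {\<one>})" using y f by blast
    qed
  qed
  then have "(\<lambda>i. (k, f(k := f k \<otimes> i))) ` (carrier D - {\<one>}) = (\<lambda>y. (k, f(k := y))) ` (carrier D - {f k})"
    by (metis (no_types, lifting) image_cong image_image)
  then show ?thesis
    unfolding wr_sgens_eq neighbours_def image_Un image_image 2 image_insert image_empty 1 by (simp add: p)
qed

lemma neighbours_iff: "p \<in> wr_carrier D \<Longrightarrow> q \<in> neighbours D p \<longleftrightarrow> (\<exists>s\<in>wr_sgens D. q = wr_mult D p s)"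
  by (simp add: wr_mult_sgens[symmetric] image_iff)

section \<open>Boundaries in terms of neighbours\<close>

lemma outer_boundary_eq_neighbours:
  assumes "F \<subseteq> wr_carrier D"
  shows "outer_boundary D F = (\<Union>p\<in>F. neighbours D p) - F"
proof -
  have "q \<in> outer_boundary D F \<longleftrightarrow> (\<exists>p\<in>F. q \<in> neighbours D p) \<and> q \<notin> F" for q
    unfolding outer_boundary_def using neighbours_iff assms by blast
  then show ?thesis by blast
qed

lemma inner_boundary_eq_neighbours:
  assumes "F \<subseteq> wr_carrier D"
  shows "inner_boundary D F = {p \<in> F. \<not> neighbours D p \<subseteq> F}"
proof -
  have "(\<exists>s\<in>wr_sgens D. wr_mult D p s \<notin> F) \<longleftrightarrow> \<not> neighbours D p \<subseteq> F" if "p \<in> F" for p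
    using wr_mult_sgens[OF subsetD[OF assms that]] by (metis image_subset_iff)
  then show ?thesis unfolding inner_boundary_def by (intro Collect_cong conj_cong refl)
qed

lemma edge_boundary_eq_neighbours:
  assumes "F \<subseteq> wr_carrier D"
  shows "edge_boundary D F = {{p, q} |p q. p \<in> F \<and> q \<in> neighbours D p \<and> q \<notin> F}"
proof -
  have "e \<in> edge_boundary D F \<longleftrightarrow> (\<exists>p q. e = {p, q} \<and> p \<in> F \<and> q \<in> neighbours D p \<and> q \<notin> F)" for e
  proof -
    have "(p \<in> F \<and> q \<in> neighbours D p \<and> q \<notin> F) \<longleftrightarrow>
        (\<exists>s. q = wr_mult D p s \<and> p \<in> F \<and> s \<in> wr_sgens D \<and> wr_mult D p s \<notin> F)" for p q
      using neighbours_iff[of p q] assms by blast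
    then show ?thesis unfolding edge_boundary_def mem_Collect_eq by metis
  qed
  then show ?thesis by (intro Set.set_eqI) simp
qed

lemma finite_outer_boundary: "finite F \<Longrightarrow> finite (outer_boundary D F)"
proof -
  assume "finite F"
  moreover have "outer_boundary D F \<subseteq> (\<lambda>(g, s). wr_mult D g s) ` (F \<times> wr_sgens D)"
    by (auto simp: outer_boundary_def)
  ultimately show ?thesis using finite_wr_sgens by (meson finite_SigmaI finite_imageI finite_subset)
qed

lemma neighbours_carrier:
  assumes "p \<in> wr_carrier D"
  shows "neighbours D p \<subseteq> wr_carrier D"
  unfolding wr_mult_sgens[OF assms, symmetric]
  using wr_mult_closed[OF assms] wr_sgens_carrier by (meson image_subsetI subsetD)

lemma outer_boundary_carrier:
  assumes "F \<subseteq> wr_carrier D"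
  shows "outer_boundary D F \<subseteq> wr_carrier D"
  unfolding outer_boundary_eq_neighbours[OF assms] using neighbours_carrier[OF subsetD[OF assms]] by blast

section \<open>Invariance under left translation\<close>

lemma neighbours_translate:
  assumes "g \<in> wr_carrier D" "p \<in> wr_carrier D"
  shows "neighbours D (wr_mult D g p) = wr_mult D g ` neighbours D p"
proof -
  have "wr_mult D (wr_mult D g p) ` wr_sgens D = wr_mult D g ` wr_mult D p ` wr_sgens D"
    unfolding image_image using wr_mult_assoc[OF assms] wr_sgens_carrier
    by (intro image_cong refl) (meson subset_iff)
  then show ?thesis using assms by (simp add: wr_mult_sgens wr_mult_closed)
qed

lemma outer_boundary_translate:
  assumes g: "g \<in> wr_carrier D" and F: "F \<subseteq> wr_carrier D"
  shows "outer_boundary D (wr_mult D g ` F) = wr_mult D g ` outer_boundary D F"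
proof -
  have gF: "wr_mult D g ` F \<subseteq> wr_carrier D" using wr_mult_closed[OF g] F by auto
  have "neighbours D (wr_mult D g p) = wr_mult D g ` neighbours D p" if "p \<in> F" for p
    using neighbours_translate[OF g] F that by blast
  then have "(\<Union>p\<in>wr_mult D g ` F. neighbours D p) = wr_mult D g ` (\<Union>p\<in>F. neighbours D p)"
    by (simp add: image_UN)
  moreover have "(\<Union>p\<in>F. neighbours D p) \<subseteq> wr_carrier D" using F neighbours_carrier by blast
  ultimately show ?thesis
    using inj_on_image_set_diff[OF inj_on_wr_mult[OF g], of "\<Union>p\<in>F. neighbours D p" F] F
    by (simp add: outer_boundary_eq_neighbours gF le_infI1 Diff_eq)
qed

lemma inner_boundary_translate:
  assumes g: "g \<in> wr_carrier D" and F: "F \<subseteq> wr_carrier D"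
  shows "inner_boundary D (wr_mult D g ` F) = wr_mult D g ` inner_boundary D F"
proof -
  have gF: "wr_mult D g ` F \<subseteq> wr_carrier D" using wr_mult_closed[OF g] F by auto
  have "neighbours D (wr_mult D g p) \<subseteq> wr_mult D g ` F \<longleftrightarrow> neighbours D p \<subseteq> F" if "p \<in> F" for p
  proof -
    have p: "p \<in> wr_carrier D" using that F by auto
    show ?thesis unfolding neighbours_translate[OF g p]
      using inj_on_wr_mult[OF g] neighbours_carrier[OF p] F 
      unfolding inj_on_def by blast
  qed
  then show ?thesis unfolding inner_boundary_eq_neighbours[OF gF] inner_boundary_eq_neighbours[OF F] by blast
qed

lemma card_translate:
  assumes "g \<in> wr_carrier D" "F \<subseteq> wr_carrier D"
  shows "card (wr_mult D g ` F) = card F"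
  by (intro card_image inj_on_subset[OF inj_on_wr_mult] assms)

section \<open>Counting outer boundary points\<close>

lemma ends_subset_outer_boundary:
  assumes F: "F \<subseteq> wr_carrier D" "finite F"
  shows "lower_ends F \<union> upper_ends F \<subseteq> outer_boundary D F"
proof -
  have *: "(Min {k. (k, f) \<in> F} - 1, f) \<in> outer_boundary D F"
       "(Max {k. (k, f) \<in> F} + 1, f) \<in> outer_boundary D F" if "f \<in> snd ` F" for f
  proof -
    let ?L = "{k. (k, f) \<in> F}"
    have L: "finite ?L" "?L \<noteq> {}" using that finite_line[OF F(2)] by auto
    have "Min ?L - 1 \<notin> ?L" using Min_le[OF L(1), of "Min ?L - 1"] by linarith
    moreover have "Max ?L + 1 \<notin> ?L" using Max_ge[OF L(1), of "Max ?L + 1"] by linarith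
    moreover have "(Min ?L, f) \<in> F" "(Max ?L, f) \<in> F" using Min_in[OF L] Max_in[OF L] by auto
    moreover have "(Min ?L - 1, f) \<in> neighbours D (Min ?L, f)" "(Max ?L + 1, f) \<in> neighbours D (Max ?L, f)"
      by (auto simp: neighbours_def)
    ultimately show "(Min ?L - 1, f) \<in> outer_boundary D F" "(Max ?L + 1, f) \<in> outer_boundary D F"
      unfolding outer_boundary_eq_neighbours[OF F(1)] by blast+
  qed
  then show ?thesis by (auto simp: lower_ends_def upper_ends_def)
qed

text \<open>The ends carry configurations of \<open>F\<close> and the other boundary points counted
  here do not, so the two families are disjoint.\<close>

lemma card_outer_boundary_ge:
  assumes F: "F \<subseteq> wr_carrier D" "finite F"
  shows "2 * card (snd ` F) + card {p \<in> outer_boundary D F. snd p \<notin> snd ` F}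
           \<le> card (outer_boundary D F)"
proof -
  let ?E = "lower_ends F \<union> upper_ends F" and ?W = "{p \<in> outer_boundary D F. snd p \<notin> snd ` F}"
  have "card (?E \<union> ?W) \<le> card (outer_boundary D F)"
    using ends_subset_outer_boundary[OF F] finite_outer_boundary[OF F(2)] by (intro card_mono) auto
  moreover have "?E \<inter> ?W = {}" by (force simp: lower_ends_def upper_ends_def)
  moreover have "finite ?E" "finite ?W"
    using F(2) finite_outer_boundary by (auto simp: lower_ends_def upper_ends_def)
  ultimately show ?thesis by (simp add: card_Un_disjoint card_ends[OF F(2)])
qed

text \<open>A point \<open>(k, f)\<close> without full direction is charged to some boundary point
  \<open>(k, f(k := y))\<close> with a new configuration. Going back means choosing a different lamp
  value at the same position, which leaves at most \<open>card (carrier D) - 1\<close>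
  preimages.\<close>

lemma card_not_full_le:
  assumes F: "F \<subseteq> wr_carrier D" "finite F"
  shows "card (F - full_dirs (carrier D) (snd ` F))
    \<le> (card (carrier D) - 1) * card {p \<in> outer_boundary D F. snd p \<notin> snd ` F}"
proof -
  let ?W = "{p \<in> outer_boundary D F. snd p \<notin> snd ` F}"
  let ?h = "\<lambda>p. (\<lambda>y. (fst p, (snd p)(fst p := y))) ` (carrier D - {snd p (fst p)})"
  have W: "finite ?W" using finite_outer_boundary[OF F(2)] by simp
  have "F - full_dirs (carrier D) (snd ` F) \<subseteq> (\<Union>p\<in>?W. ?h p)"
  proof
    fix p assume p: "p \<in> F - full_dirs (carrier D) (snd ` F)"
    obtain k f where kf: "p = (k, f)" by fastforce
    have f: "f \<in> snd ` F" using p kf by force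
    then obtain y where y: "y \<in> carrier D" "f(k := y) \<notin> snd ` F"
      using p kf by (auto simp: full_dirs_def)
    have fk: "f k \<in> carrier D" using p kf F by (auto simp: wr_carrier_def)
    have yk: "y \<noteq> f k" using y f by auto
    have "(k, f(k := y)) \<notin> F" using y(2) by force
    moreover have "(k, f(k := y)) \<in> neighbours D p" using y(1) yk kf by (auto simp: neighbours_def)
    ultimately have "(k, f(k := y)) \<in> ?W"
      using y(2) p by (auto simp: outer_boundary_eq_neighbours[OF F(1)])
    moreover have "p \<in> ?h (k, f(k := y))"
      using fk yk kf by (auto simp: image_iff intro!: bexI[of _ "f k"])
    ultimately show "p \<in> (\<Union>p\<in>?W. ?h p)" by blast
  qed
  then have "card (F - full_dirs (carrier D) (snd ` F)) \<le> card (\<Union>p\<in>?W. ?h p)"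
    using W finite_carrier by (intro card_mono) auto
  also have "\<dots> \<le> (\<Sum>p\<in>?W. card (?h p))" by (rule card_UN_le[OF W])
  also have "\<dots> \<le> (\<Sum>p\<in>?W. card (carrier D) - 1)"
  proof (rule sum_mono)
    fix p assume "p \<in> ?W"
    then have "p \<in> wr_carrier D" using outer_boundary_carrier[OF F(1)] by auto
    then have "snd p (fst p) \<in> carrier D" by (auto simp: wr_carrier_def)
    then have "card (carrier D - {snd p (fst p)}) = card (carrier D) - 1" using finite_carrier by simp
    moreover have "card (?h p) \<le> card (carrier D - {snd p (fst p)})"
      using finite_carrier by (intro card_image_le) auto
    ultimately show "card (?h p) \<le> card (carrier D) - 1" by simp
  qed
  finally show ?thesis by (simp add: mult.commute)
qed

section \<open>Products of positions with subcubes\<close>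

lemma mem_subcube_one_iff:
  "f \<in> subcube (carrier D) {1..int n} (\<lambda>_. \<one>) \<longleftrightarrow>
    (\<forall>x. f x \<in> carrier D) \<and> finite (supp D f) \<and> supp D f \<subseteq> {1..int n}"
proof -
  have fin: "supp D f \<subseteq> {1..int n} \<Longrightarrow> finite (supp D f)" by (erule finite_subset) simp
  have "f x \<in> carrier D" if "f \<in> subcube (carrier D) {1..int n} (\<lambda>_. \<one>)" for x
    using that by (cases "x \<in> {1..int n}") (auto simp: subcube_def)
  moreover have "supp D f \<subseteq> {1..int n} \<longleftrightarrow> (\<forall>x. x \<notin> {1..int n} \<longrightarrow> f x = \<one>)"
    by (auto simp: supp_def)
  ultimately show ?thesis using fin unfolding subcube_def by blast
qed

lemma Fn_eq: "Fn D n = {1..int n} \<times> subcube (carrier D) {1..int n} (\<lambda>_. \<one>)"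
  by (auto simp: Fn_def wr_carrier_def mem_subcube_one_iff subset_iff)

text \<open>Equality in the counting argument only yields an arbitrary finite set \<open>J\<close>
  of positions. The ends already exhaust the allowed boundary, so there is no room for gaps and
  \<open>J\<close> is an interval; after that, \<open>F\<close> is visibly a translate.\<close>

lemma translate_of_product:
  assumes J: "finite J" "card J = n" "n \<ge> 1"
    and F: "F = J \<times> subcube (carrier D) J f0" "F \<subseteq> wr_carrier D" "F \<noteq> {}"
    and out: "card (outer_boundary D F) \<le> 2 * card (carrier D) ^ n"
  shows "\<exists>g\<in>wr_carrier D. F = wr_mult D g ` Fn D n"
proof -
  let ?A = "subcube (carrier D) J f0"
  have Jne: "J \<noteq> {}" using J(2,3) by auto
  have finF: "finite F" unfolding F(1) by (intro finite_cartesian_product finite_subcube J(1) finite_carrier)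
  have A: "snd ` F = ?A" using F(1) Jne by force
  have L: "{k. (k, f) \<in> F} = J" if "f \<in> ?A" for f using that F(1) by auto
  have "card (lower_ends F \<union> upper_ends F) = 2 * card (carrier D) ^ n"
    using card_ends[OF finF] A card_subcube[OF J(1)] J(2) by metis
  then have ends: "outer_boundary D F = lower_ends F \<union> upper_ends F"
    using ends_subset_outer_boundary[OF F(2) finF] finite_outer_boundary[OF finF] out
    by (metis card_seteq)
  obtain f1 where f1: "f1 \<in> ?A" using F(1,3) by auto
  \<comment> \<open>At the first gap \<open>j\<close> the position \<open>j - 1\<close> lies in
    \<open>J\<close>, so \<open>(j, f1)\<close> is a boundary point strictly between the two ends of
    its line.\<close>
  have interval: "J = {Min J..Max J}"
  proof (rule ccontr)
    assume "J \<noteq> {Min J..Max J}"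
    then have ne: "{Min J..Max J} - J \<noteq> {}" using J(1) by force
    define j where "j = Min ({Min J..Max J} - J)"
    have j: "j \<in> {Min J..Max J} - J" unfolding j_def using ne by (intro Min_in) auto
    then have "j \<noteq> Min J" using Min_in[OF J(1) Jne] by auto
    then have "j - 1 \<in> {Min J..Max J}" using j by auto
    moreover have "j - 1 \<notin> {Min J..Max J} - J"
      using Min_le[of "{Min J..Max J} - J" "j - 1"] unfolding j_def[symmetric] by auto
    ultimately have "j - 1 \<in> J" by auto
    then have "(j, f1) \<in> outer_boundary D F"
      using j f1 F(1) unfolding outer_boundary_eq_neighbours[OF F(2)] neighbours_def by force
    then have "j = Min J - 1 \<or> j = Max J + 1"
      unfolding ends lower_ends_def upper_ends_def A using L[OF f1] by auto
    then show False using j by auto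
  qed
  \<comment> \<open>The positions of \<open>Fn D n\<close> start at 1, hence the shift by
    \<open>Min J - 1\<close>.\<close>
  define a where "a = Min J - 1"
  have cJ: "int n = Max J - Min J + 1"
  proof -
    have "Min J \<le> Max J" using Max_in[OF J(1) Jne] Min_le[OF J(1)] by blast
    moreover have "card J = card {Min J..Max J}" using interval by (rule arg_cong)
    ultimately show ?thesis unfolding J(2) by simp
  qed
  have Ja: "x \<in> J \<longleftrightarrow> x - a \<in> {1..int n}" for x
    by (subst interval) (auto simp: a_def cJ)
  define h where "h = (\<lambda>x. if x \<in> J then \<one> else f0 x)"
  have "h \<in> ?A" by (auto simp: h_def subcube_def)
  then have "(Min J, h) \<in> wr_carrier D" using F(1,2) Min_in[OF J(1) Jne] by auto
  then have h: "(a, h) \<in> wr_carrier D" by (auto simp: wr_carrier_def)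
  have f0: "f0 x \<in> carrier D" if "x \<notin> J" for x
    using h that by (auto simp: wr_carrier_def h_def dest: spec[of _ x])
  have "F = wr_mult D (a, h) ` Fn D n"
  proof
    show "F \<subseteq> wr_mult D (a, h) ` Fn D n"
    proof
      fix p assume p: "p \<in> F"
      obtain k f where kf: "p = (k, f)" by fastforce
      have k: "k \<in> J" and f: "f \<in> ?A" using p F(1) kf by auto
      define f' where "f' = (\<lambda>x. if x \<in> {1..int n} then f (x + a) else \<one>)"
      have "(k - a, f') \<in> Fn D n"
        unfolding Fn_eq using k f Ja[of "_ + a"] by (auto simp: f'_def subcube_def Ja)
      moreover have "h x \<otimes> f' (x - a) = f x" for x
        using f f0 by (cases "x \<in> J") (auto simp: f'_def h_def subcube_def Ja)
      then have "wr_mult D (a, h) (k - a, f') = p" by (simp add: wr_mult_def kf)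
      ultimately show "p \<in> wr_mult D (a, h) ` Fn D n" by force
    qed
    show "wr_mult D (a, h) ` Fn D n \<subseteq> F"
    proof (rule image_subsetI)
      fix p assume p: "p \<in> Fn D n"
      obtain k f where kf: "p = (k, f)" by fastforce
      have k: "k \<in> {1..int n}" and f: "f \<in> subcube (carrier D) {1..int n} (\<lambda>_. \<one>)"
        using p kf by (auto simp: Fn_eq)
      have "a + k \<in> J" using k by (simp add: Ja)
      moreover have "(\<lambda>x. h x \<otimes> f (x - a)) \<in> ?A"
      proof -
        have "h x \<otimes> f (x - a) \<in> carrier D" if "x \<in> J" for x
          using f that Ja[of x] by (auto simp: h_def subcube_def)
        moreover have "h x \<otimes> f (x - a) = f0 x" if "x \<notin> J" for x
          using f f0[OF that] that Ja[of x] by (auto simp: h_def subcube_def)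
        ultimately show ?thesis by (simp add: subcube_def)
      qed
      ultimately show "wr_mult D (a, h) p \<in> F" by (simp add: F(1) wr_mult_def kf)
    qed
  qed
  then show ?thesis using h by blast
qed

section \<open>The isoperimetric inequalities\<close>

text \<open>For the trivial lamp group the group is \<open>\<int>\<close> and the bound on the boundary says nothing about
  the size of \<open>F\<close>, hence the last hypothesis.\<close>
lemma card_le_outer_boundary:
  assumes n: "n \<ge> 1" "n \<ge> 2 * (card (carrier D) - 1)"
    and F: "F \<subseteq> wr_carrier D" "finite F" "F \<noteq> {}"
    and out: "card (outer_boundary D F) \<le> 2 * card (carrier D) ^ n"
    and triv: "card (carrier D) = 1 \<Longrightarrow> card F \<le> n"
  shows "2 * card F \<le> n * card (outer_boundary D F)"
    and "2 * card F = n * card (outer_boundary D F) \<Longrightarrow> \<exists>g\<in>wr_carrier D. F = wr_mult D g ` Fn D n"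
proof -
  define A where "A = snd ` F"
  define W where "W = {p \<in> outer_boundary D F. snd p \<notin> A}"
  have A: "finite A" "A \<noteq> {}" using F by (auto simp: A_def)
  have AC: "f k \<in> carrier D" if "f \<in> A" for f k
    using that F(1) by (auto simp: A_def wr_carrier_def)
  have O: "2 * card A + card W \<le> card (outer_boundary D F)"
    using card_outer_boundary_ge[OF F(1,2)] by (simp add: A_def W_def)
  have "2 * card F \<le> n * card (outer_boundary D F) \<and>
    (2 * card F = n * card (outer_boundary D F) \<longrightarrow> (\<exists>g\<in>wr_carrier D. F = wr_mult D g ` Fn D n))"
  proof (cases "card (carrier D) = 1")
    \<comment> \<open>Here \<open>ln (card (carrier D))\<close> is 0 and the entropy bound is empty.
      The count is direct: \<open>F\<close> is a set of positions of size at most \<open>n\<close>,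
      and it has two ends.\<close>
    case True
    then obtain z where z: "carrier D = {z}" by (auto simp: card_1_singleton_iff)
    then have C1: "carrier D = {\<one>}" using one_closed by auto
    have "F \<subseteq> fst ` F \<times> {\<lambda>_. \<one>}"
      using F(1) C1 by (force simp: wr_carrier_def)
    then have "F = fst ` F \<times> {\<lambda>_. \<one>}" by force
    moreover have "{\<lambda>_. \<one>} = subcube (carrier D) (fst ` F) (\<lambda>_. \<one>)"
      unfolding C1 by (auto simp: subcube_def fun_eq_iff) (metis image_iff)
    ultimately have FJ: "F = fst ` F \<times> subcube (carrier D) (fst ` F) (\<lambda>_. \<one>)" by simp
    then have cF: "card F = card (fst ` F)"
      using card_subcube[of "fst ` F" "carrier D"] F(2) True
      by (metis card_cartesian_product finite_imageI mult.right_neutral power_one)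
    have "card A \<ge> 1" using A by (simp add: Suc_leI card_gt_0_iff)
    then have O2: "card (outer_boundary D F) \<ge> 2" using O by linarith
    then have nO: "2 * n \<le> n * card (outer_boundary D F)" by simp
    have "2 * card F \<le> 2 * n" using triv True by simp
    moreover have "\<exists>g\<in>wr_carrier D. F = wr_mult D g ` Fn D n"
      if "2 * card F = n * card (outer_boundary D F)"
    proof (rule translate_of_product[OF _ _ n(1) FJ F(1,3) out])
      show "card (fst ` F) = n" using that nO triv[OF True] cF by linarith
    qed (use F in auto)
    ultimately show ?thesis using nO by linarith
  next
    case False
    define d where "d = card (carrier D)"
    have d: "d \<ge> 2" using False card_carrier_pos by (simp add: d_def)
    define S where "S = full_dirs (carrier D) A"
    have finS: "finite S" unfolding S_def using finite_full_dirs A finite_carrier d d_def by blast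
    have main: "card S * ln d \<le> card A * ln (card A)"
      "card S * ln d = card A * ln (card A) \<Longrightarrow> \<exists>J f0. finite J \<and> A = subcube (carrier D) J f0"
      using card_full_dirs_le[OF finite_carrier _ A] AC d unfolding d_def S_def by auto
    have R: "card (F - S) \<le> (d - 1) * card W"
      using card_not_full_le[OF F(1,2)] by (simp add: A_def W_def S_def d_def)
    have cF: "card F = card (F \<inter> S) + card (F - S)"
      using F(2) card_Int_Diff by blast
    have I: "card (F \<inter> S) \<le> card S" using finS by (simp add: card_mono)
    have lnd: "ln d > 0" using d by simp
    have Npos: "card A > 0" using A by (simp add: card_gt_0_iff)
    \<comment> \<open>The bound on the boundary enters here: it caps the number of configurations,
      so their logarithm to base \<open>d\<close> is at most \<open>n\<close>.\<close>
    have N: "card A \<le> d ^ n" using O out by (simp add: d_def)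
    have lnN: "ln (card A) \<le> n * ln d"
    proof -
      have "ln (card A) \<le> ln (real d ^ n)"
        using N Npos d by (subst ln_le_cancel_iff) (simp_all flip: of_nat_power)
      then show ?thesis using d by (simp add: ln_realpow)
    qed
    have SN: "card A * ln (card A) \<le> card A * (n * ln d)"
      using lnN by (intro mult_left_mono) auto
    have "card S * ln d \<le> (n * card A) * ln d" using main(1) SN by (simp add: ac_simps)
    then have "real (card S) \<le> real (n * card A)" using lnd by (metis mult_le_cancel_right_pos)
    then have S: "card S \<le> n * card A" by (metis of_nat_le_iff)
    \<comment> \<open>This is where \<open>n \<ge> 2 (d - 1)\<close> is used: charging
      \<open>d - 1\<close> points to each member of \<open>W\<close> costs no more than the factor
      \<open>n / 2\<close> available per boundary point.\<close>
    have "2 * ((d - 1) * card W) \<le> n * card W"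
      using n(2) mult_le_mono1[of "2 * (d - 1)" n "card W"] by (simp add: d_def ac_simps)
    moreover have "n * (2 * card A + card W) \<le> n * card (outer_boundary D F)"
      using O by (rule mult_le_mono2)
    moreover have "n * (2 * card A + card W) = 2 * (n * card A) + n * card W"
      by (simp add: algebra_simps)
    ultimately have chain: "2 * card (F - S) \<le> n * card W"
      "2 * (n * card A) + n * card W \<le> n * card (outer_boundary D F)"
      using R by linarith+
    have "\<exists>g\<in>wr_carrier D. F = wr_mult D g ` Fn D n"
      if eq: "2 * card F = n * card (outer_boundary D F)"
    proof -
      \<comment> \<open>Equality at the end makes every link of the chain an equality. The first
        link then forces \<open>card A = d ^ n\<close> and the equality case of the entropy
        bound.\<close>
      have 1: "card S = n * card A" and 2: "card (F \<inter> S) = card S"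
        using eq chain cF I S by linarith+
      have "card A * ln (card A) = card A * (n * ln d)"
        using main(1) SN unfolding 1 by (simp add: ac_simps)
      then have lnA: "ln (card A) = n * ln d" using Npos by simp
      then have "ln (card A) = ln (real d ^ n)" using d by (simp add: ln_realpow)
      then have "real (card A) = real d ^ n" using Npos d by simp
      then have NA: "card A = d ^ n" by (metis of_nat_eq_iff of_nat_power)
      have "card S * ln d = card A * ln (card A)" unfolding 1 lnA by simp
      then obtain J f0 where J: "finite J" "A = subcube (carrier D) J f0" using main(2) by blast
      have "d ^ n = d ^ card J" using NA J card_subcube by (metis d_def)
      then have cJ: "card J = n" using d by simp
      \<comment> \<open>The ends alone now number \<open>2 * d ^ n\<close>, the maximum
        allowed.\<close>
      have "card W = 0" using O out NA by (simp add: d_def)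
      then have "card (F - S) = 0" using R by simp
      then have "F \<subseteq> S" using F(2) by auto
      moreover have "F \<inter> S = S" using 2 finS by (metis card_subset_eq inf_le2)
      ultimately have FS: "F = S" by auto
      \<comment> \<open>The full directions of a subcube are exactly its free coordinates, since
        \<open>d \<ge> 2\<close>.\<close>
      have SJ: "S = J \<times> A"
      proof -
        have "(\<forall>y\<in>carrier D. f(k := y) \<in> A) \<longleftrightarrow> k \<in> J" if f: "f \<in> A" for f k
        proof
          assume "k \<in> J"
          then show "\<forall>y\<in>carrier D. f(k := y) \<in> A" using f unfolding J by (auto simp: subcube_def)
        next
          assume a: "\<forall>y\<in>carrier D. f(k := y) \<in> A"
          show "k \<in> J"
          proof (rule ccontr)
            assume "k \<notin> J"
            then have "(f(k := y)) k = f0 k" if "y \<in> carrier D" for y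
              using a that unfolding J subcube_def by blast
            then have "carrier D \<subseteq> {f0 k}" by auto
            from card_mono[OF _ this] d show False by (simp add: d_def)
          qed
        qed
        then show ?thesis unfolding S_def full_dirs_def by blast
      qed
      show ?thesis
        by (rule translate_of_product[OF J(1) cJ n(1) _ F(1,3) out, of f0]) (use FS SJ J in simp)
    qed
    then show ?thesis using chain cF I S by linarith
  qed
  then show "2 * card F \<le> n * card (outer_boundary D F)"
    and "2 * card F = n * card (outer_boundary D F) \<Longrightarrow> \<exists>g\<in>wr_carrier D. F = wr_mult D g ` Fn D n"
    by auto
qed

section \<open>Boundaries of the extremal sets\<close>

lemma Fn_carrier: "Fn D n \<subseteq> wr_carrier D"
  by (auto simp: Fn_def)

lemma card_Fn: "card (Fn D n) = n * card (carrier D) ^ n"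
  by (simp add: Fn_eq card_cartesian_product card_subcube)

lemma outer_boundary_Fn:
  assumes "n \<ge> 1"
  shows "outer_boundary D (Fn D n) = {0, int n + 1} \<times> subcube (carrier D) {1..int n} (\<lambda>_. \<one>)"
    (is "_ = _ \<times> ?Q")
proof
  have upd: "f(k := y) \<in> ?Q" if "f \<in> ?Q" "k \<in> {1..int n}" "y \<in> carrier D" for f k y
    using that by (auto simp: subcube_def)
  show "outer_boundary D (Fn D n) \<subseteq> {0, int n + 1} \<times> ?Q"
  proof
    fix q assume "q \<in> outer_boundary D (Fn D n)"
    then obtain k f where kf: "(k, f) \<in> Fn D n" "q \<in> neighbours D (k, f)" and q: "q \<notin> Fn D n"
      unfolding outer_boundary_eq_neighbours[OF Fn_carrier] by auto
    then have k: "k \<in> {1..int n}" and f: "f \<in> ?Q" by (auto simp: Fn_eq)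
    have "q \<noteq> (k, f(k := y))" if "y \<in> carrier D" for y
      using q upd[OF f k that] k by (auto simp: Fn_eq)
    then have "q = (k + 1, f) \<or> q = (k - 1, f)" using kf(2) by (auto simp: neighbours_def)
    then show "q \<in> {0, int n + 1} \<times> ?Q" using k f q by (auto simp: Fn_eq)
  qed
  show "{0, int n + 1} \<times> ?Q \<subseteq> outer_boundary D (Fn D n)"
  proof
    fix q assume "q \<in> {0, int n + 1} \<times> ?Q"
    then obtain f where f: "f \<in> ?Q" and q: "q = (0, f) \<or> q = (int n + 1, f)" by auto
    have "(1, f) \<in> Fn D n" "(int n, f) \<in> Fn D n" using f assms by (auto simp: Fn_eq)
    moreover have "(0, f) \<in> neighbours D (1, f)" "(int n + 1, f) \<in> neighbours D (int n, f)" by (auto simp: neighbours_def)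
    moreover have "q \<notin> Fn D n" using q by (auto simp: Fn_eq)
    ultimately show "q \<in> outer_boundary D (Fn D n)"
      unfolding outer_boundary_eq_neighbours[OF Fn_carrier] using q by blast
  qed
qed

lemma card_outer_boundary_Fn:
  "n \<ge> 1 \<Longrightarrow> card (outer_boundary D (Fn D n)) = 2 * card (carrier D) ^ n"
  by (simp add: outer_boundary_Fn card_cartesian_product card_subcube)

lemma finite_edge_boundary: "finite F \<Longrightarrow> finite (edge_boundary D F)"
proof -
  assume "finite F"
  moreover have "edge_boundary D F \<subseteq> (\<lambda>(g, s). {g, wr_mult D g s}) ` (F \<times> wr_sgens D)"
    by (auto simp: edge_boundary_def)
  ultimately show ?thesis using finite_wr_sgens by (meson finite_SigmaI finite_imageI finite_subset)
qed

lemma card_outer_boundary_le_edge_boundary: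
  assumes "finite F"
  shows "card (outer_boundary D F) \<le> card (edge_boundary D F)"
proof -
  \<comment> \<open>A boundary edge has exactly one endpoint outside \<open>F\<close>, which
    \<open>the_elem\<close> extracts.\<close>
  have "outer_boundary D F \<subseteq> (\<lambda>e. the_elem (e - F)) ` edge_boundary D F"
  proof
    fix q assume "q \<in> outer_boundary D F"
    then obtain g s where gs: "q = wr_mult D g s" "g \<in> F" "s \<in> wr_sgens D" "q \<notin> F"
      by (auto simp: outer_boundary_def)
    then have "{g, q} \<in> edge_boundary D F" unfolding edge_boundary_def by blast
    moreover have "{g, q} - F = {q}" using gs by auto
    then have "q = the_elem ({g, q} - F)" by simp
    ultimately show "q \<in> (\<lambda>e. the_elem (e - F)) ` edge_boundary D F" by (rule rev_image_eqI)
  qed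
  then show ?thesis using finite_edge_boundary[OF assms] by (rule surj_card_le[rotated])
qed

lemma finite_Fn: "finite (Fn D n)"
  by (simp add: Fn_eq finite_subcube finite_carrier)

text \<open>Listing the edges at both ends gives the upper bound; the lower bound is the general
  comparison with the outer boundary.\<close>

lemma card_edge_boundary_Fn:
  assumes "n \<ge> 1"
  shows "card (edge_boundary D (Fn D n)) = 2 * card (carrier D) ^ n"
proof (rule antisym)
  let ?Q = "subcube (carrier D) {1..int n} (\<lambda>_. \<one>)"
  have Q: "finite ?Q" by (simp add: finite_subcube finite_carrier)
  have "edge_boundary D (Fn D n) \<subseteq>
    (\<lambda>f. {(1, f), (0, f)}) ` ?Q \<union> (\<lambda>f. {(int n, f), (int n + 1, f)}) ` ?Q"
    (is "_ \<subseteq> ?L \<union> ?R")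
  proof
    fix e assume "e \<in> edge_boundary D (Fn D n)"
    then obtain p q where e: "e = {p, q}" "p \<in> Fn D n" "q \<in> neighbours D p" "q \<notin> Fn D n"
      unfolding edge_boundary_eq_neighbours[OF Fn_carrier] by blast
    then have "q \<in> outer_boundary D (Fn D n)" unfolding outer_boundary_eq_neighbours[OF Fn_carrier] by blast
    then obtain f where f: "f \<in> ?Q" and q: "q = (0, f) \<or> q = (int n + 1, f)"
      using outer_boundary_Fn[OF assms] by auto
    have "p = (fst q - 1, f) \<or> p = (fst q + 1, f)"
      using e(2,3) q by (cases p) (auto simp: neighbours_def Fn_eq)
    then have "q = (0, f) \<and> p = (1, f) \<or> q = (int n + 1, f) \<and> p = (int n, f)"
      using q e(2) by (auto simp: Fn_eq)
    then show "e \<in> ?L \<union> ?R" using f e(1) by auto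
  qed
  then have "card (edge_boundary D (Fn D n)) \<le> card (?L \<union> ?R)" using Q by (intro card_mono) auto
  also have "\<dots> \<le> card ?L + card ?R"
    by (rule card_Un_le)
  also have "\<dots> \<le> card ?Q + card ?Q" using Q by (intro add_mono card_image_le)
  finally show "card (edge_boundary D (Fn D n)) \<le> 2 * card (carrier D) ^ n"
    by (simp add: card_subcube)
  show "2 * card (carrier D) ^ n \<le> card (edge_boundary D (Fn D n))"
    using card_outer_boundary_le_edge_boundary[OF finite_Fn] card_outer_boundary_Fn[OF assms] by metis
qed

lemma Fn_Un_outer_boundary:
  assumes "n \<ge> 1"
  shows "Fn D n \<union> outer_boundary D (Fn D n)
    = {0..int n + 1} \<times> subcube (carrier D) {1..int n} (\<lambda>_. \<one>)"
  unfolding outer_boundary_Fn[OF assms] unfolding Fn_eq by auto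

lemma Fn_Un_outer_boundary_carrier: "Fn D n \<union> outer_boundary D (Fn D n) \<subseteq> wr_carrier D"
  using Fn_carrier outer_boundary_carrier[OF Fn_carrier] by blast

lemma card_Fn_Un_outer_boundary:
  "n \<ge> 1 \<Longrightarrow> card (Fn D n \<union> outer_boundary D (Fn D n)) = (n + 2) * card (carrier D) ^ n"
  by (simp add: Fn_Un_outer_boundary card_cartesian_product card_subcube nat_add_distrib)

lemma inner_boundary_Fn_Un_outer_boundary:
  assumes "n \<ge> 1"
  shows "inner_boundary D (Fn D n \<union> outer_boundary D (Fn D n)) = outer_boundary D (Fn D n)"
proof -
  let ?U = "Fn D n \<union> outer_boundary D (Fn D n)"
  have "p \<in> inner_boundary D ?U \<longleftrightarrow> p \<in> outer_boundary D (Fn D n)" for p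
  proof
    assume "p \<in> inner_boundary D ?U"
    then have "p \<in> ?U" "\<not> neighbours D p \<subseteq> ?U"
      unfolding inner_boundary_eq_neighbours[OF Fn_Un_outer_boundary_carrier] by auto
    then show "p \<in> outer_boundary D (Fn D n)"
      unfolding outer_boundary_eq_neighbours[OF Fn_carrier] by blast
  next
    assume p: "p \<in> outer_boundary D (Fn D n)"
    obtain k f where kf: "p = (k, f)" by fastforce
    have "k = 0 \<or> k = int n + 1" using p kf outer_boundary_Fn[OF assms] by auto
    then have "(k - 1, f) \<notin> ?U \<or> (k + 1, f) \<notin> ?U"
      unfolding Fn_Un_outer_boundary[OF assms] by auto
    moreover have "(k - 1, f) \<in> neighbours D p" "(k + 1, f) \<in> neighbours D p" by (auto simp: neighbours_def kf)
    ultimately show "p \<in> inner_boundary D ?U"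
      unfolding inner_boundary_eq_neighbours[OF Fn_Un_outer_boundary_carrier] using p by blast
  qed
  then show ?thesis by blast
qed

section \<open>Both inequalities with their equality cases, cleared of denominators\<close>

lemma outer_boundary_isoperimetry:
  assumes n: "n \<ge> 1" "n \<ge> 2 * (card (carrier D) - 1)"
    and F: "F \<subseteq> wr_carrier D" "finite F" "F \<noteq> {}" "card F \<le> card (Fn D n)"
  shows "2 * card F \<le> n * card (outer_boundary D F)"
    and "2 * card F = n * card (outer_boundary D F) \<longleftrightarrow> (\<exists>g\<in>wr_carrier D. F = wr_mult D g ` Fn D n)"
proof -
  let ?c = "card (carrier D) ^ n" and ?O = "card (outer_boundary D F)"
  have le: "card F \<le> n * ?c" using F(4) card_Fn by simp
  \<comment> \<open>A boundary larger than that of \<open>Fn D n\<close> already gives strict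
    inequality from the size bound alone, so \<open>card_le_outer_boundary\<close> is needed only
    for the remaining case.\<close>
  have gt: "2 * card F < n * ?O" if "2 * ?c < ?O"
  proof -
    have "n * (2 * ?c) < n * ?O" using that n(1) by simp
    then show ?thesis using le by linarith
  qed
  have triv: "card (carrier D) = 1 \<Longrightarrow> card F \<le> n" using le by simp
  note core = card_le_outer_boundary[OF n F(1-3) _ triv]
  show "2 * card F \<le> n * ?O" using core(1) gt by (meson less_imp_le not_le)
  show "2 * card F = n * ?O \<longleftrightarrow> (\<exists>g\<in>wr_carrier D. F = wr_mult D g ` Fn D n)"
  proof
    show "2 * card F = n * ?O \<Longrightarrow> \<exists>g\<in>wr_carrier D. F = wr_mult D g ` Fn D n"
      using core(2) gt by (metis less_irrefl not_le)
    assume "\<exists>g\<in>wr_carrier D. F = wr_mult D g ` Fn D n"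
    then obtain g where g: "g \<in> wr_carrier D" "F = wr_mult D g ` Fn D n" by blast
    have "card F = n * ?c" using g card_translate[OF g(1) Fn_carrier] card_Fn by simp
    moreover have "?O = 2 * ?c"
      using g outer_boundary_translate[OF g(1) Fn_carrier] card_outer_boundary_Fn[OF n(1)]
        card_translate[OF g(1) outer_boundary_carrier[OF Fn_carrier]] by simp
    ultimately show "2 * card F = n * ?O" by simp
  qed
qed

text \<open>Adding \<open>2 * card ?I\<close> to \<open>2 * card G \<le> n * card ?I\<close> turns
  the factor \<open>n\<close> into \<open>n + 2\<close>. In the equality case \<open>G\<close> is a
  translate of \<open>Fn D n\<close> and its outer boundary is all of \<open>?I\<close>, so
  \<open>F\<close> is \<open>G\<close> together with its outer boundary.\<close>

lemma inner_boundary_isoperimetry: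
  assumes n: "n \<ge> 1" "n \<ge> 2 * (card (carrier D) - 1)"
    and F: "F \<subseteq> wr_carrier D" "finite F" "F \<noteq> {}"
      "card F \<le> card (Fn D n \<union> outer_boundary D (Fn D n))"
  shows "2 * card F \<le> (n + 2) * card (inner_boundary D F)"
    and "2 * card F = (n + 2) * card (inner_boundary D F) \<longleftrightarrow>
      (\<exists>g\<in>wr_carrier D. F = wr_mult D g ` (Fn D n \<union> outer_boundary D (Fn D n)))"
proof -
  let ?c = "card (carrier D) ^ n" and ?I = "inner_boundary D F"
    and ?U = "Fn D n \<union> outer_boundary D (Fn D n)"
  define G where "G = F - ?I"
  have le: "card F \<le> (n + 2) * ?c" using F(4) card_Fn_Un_outer_boundary[OF n(1)] by simp
  have IF: "?I \<subseteq> F" by (auto simp: inner_boundary_def)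
  have finI: "finite ?I" using IF F(2) finite_subset by blast
  have cF: "card F = card G + card ?I"
    using card_Diff_subset[OF finI IF] card_mono[OF F(2) IF] by (simp add: G_def)
  have G: "G \<subseteq> wr_carrier D" "finite G" using F by (auto simp: G_def)
  have OI: "outer_boundary D G \<subseteq> ?I"
    unfolding outer_boundary_eq_neighbours[OF G(1)] by (auto simp: G_def inner_boundary_eq_neighbours[OF F(1)])
  have cOI: "card (outer_boundary D G) \<le> card ?I" using card_mono[OF finI OI] .
  have "2 * card F \<le> (n + 2) * card ?I \<and>
    (2 * card F = (n + 2) * card ?I \<longrightarrow> (\<exists>g\<in>wr_carrier D. F = wr_mult D g ` ?U))"
  proof (cases "2 * ?c < card ?I")
    case True
    then have "(n + 2) * (2 * ?c) < (n + 2) * card ?I" by (intro mult_less_mono2) auto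
    then show ?thesis using le by linarith
  next
    case False
    show ?thesis
    proof (cases "G = {}")
      case True
      \<comment> \<open>If every point is a boundary point, the inequality is strict because
        \<open>n + 2 > 2\<close>.\<close>
      then have "card ?I = card F" using cF by simp
      moreover have "card F > 0" using F by (simp add: card_gt_0_iff)
      ultimately show ?thesis using n(1) by simp
    next
      case Gne: False
      have "snd ` G \<noteq> {}" using Gne by simp
      then have "card (snd ` G) > 0" using G(2) card_gt_0_iff by blast
      then have I2: "2 \<le> card ?I" using card_outer_boundary_ge[OF G] cOI by linarith
      \<comment> \<open>For trivial lamps \<open>card F \<le> n + 2\<close>, and removing at least
        two inner boundary points leaves at most \<open>n\<close>.\<close>
      have triv: "card G \<le> n" if "card (carrier D) = 1" using le I2 cF that by simp
      have out: "card (outer_boundary D G) \<le> 2 * ?c" using cOI False by linarith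
      note core = card_le_outer_boundary[OF n G Gne out triv]
      have nO: "n * card (outer_boundary D G) \<le> n * card ?I" using cOI by (rule mult_le_mono2)
      have eq: "(n + 2) * card ?I = n * card ?I + 2 * card ?I" by (simp add: algebra_simps)
      have "\<exists>g\<in>wr_carrier D. F = wr_mult D g ` ?U" if e: "2 * card F = (n + 2) * card ?I"
      proof -
        have "2 * card G = n * card (outer_boundary D G)" and
          "n * card (outer_boundary D G) = n * card ?I"
          using e core(1) nO eq cF by linarith+
        then obtain g where g: "g \<in> wr_carrier D" "G = wr_mult D g ` Fn D n"
          and "card (outer_boundary D G) = card ?I" using core(2) n(1) by auto
        then have "outer_boundary D G = ?I" using card_subset_eq[OF finI OI] by blast
        then have "F = G \<union> outer_boundary D G" using IF by (auto simp: G_def)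
        then have "F = wr_mult D g ` ?U"
          using g outer_boundary_translate[OF g(1) Fn_carrier] by (simp add: image_Un)
        then show ?thesis using g(1) by blast
      qed
      then show ?thesis using core(1) nO eq cF by linarith
    qed
  qed
  moreover have "2 * card F = (n + 2) * card ?I" if "\<exists>g\<in>wr_carrier D. F = wr_mult D g ` ?U"
  proof -
    from that obtain g where g: "g \<in> wr_carrier D" "F = wr_mult D g ` ?U" by blast
    have "card F = (n + 2) * ?c"
      using g card_translate[OF g(1) Fn_Un_outer_boundary_carrier] card_Fn_Un_outer_boundary[OF n(1)]
      by simp
    moreover have "card ?I = 2 * ?c"
      using g inner_boundary_translate[OF g(1) Fn_Un_outer_boundary_carrier]
        inner_boundary_Fn_Un_outer_boundary[OF n(1)] card_outer_boundary_Fn[OF n(1)]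
        card_translate[OF g(1) outer_boundary_carrier[OF Fn_carrier]] by metis
    ultimately show ?thesis by simp
  qed
  ultimately show "2 * card F \<le> (n + 2) * card ?I"
    and "2 * card F = (n + 2) * card ?I \<longleftrightarrow> (\<exists>g\<in>wr_carrier D. F = wr_mult D g ` ?U)"
    by auto
qed

end

text \<open>Both optimal ratios have the form \<open>2 / m\<close>, with \<open>m = n\<close> for
  the outer and \<open>m = n + 2\<close> for the inner boundary.\<close>

lemma two_div_le_iff:
  fixes a b m :: nat
  assumes "b > 0" "m > 0"
  shows "2 / real m \<le> real a / real b \<longleftrightarrow> 2 * b \<le> m * a"
    and "real a / real b = 2 / real m \<longleftrightarrow> 2 * b = m * a"
proof -
  have "2 / real m \<le> real a / real b \<longleftrightarrow> real (2 * b) \<le> real (m * a)"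
    using assms by (simp add: field_simps)
  then show "2 / real m \<le> real a / real b \<longleftrightarrow> 2 * b \<le> m * a" by (metis of_nat_le_iff)
  have "real a / real b = 2 / real m \<longleftrightarrow> real (2 * b) = real (m * a)"
    using assms by (auto simp: field_simps)
  then show "real a / real b = 2 / real m \<longleftrightarrow> 2 * b = m * a" by (metis of_nat_eq_iff)
qed

theorem mainTheorem2:
  fixes D :: "('a, 'b) monoid_scheme" and n :: nat
  assumes "group D" and "finite (carrier D)"
    and "n \<ge> 1" and "n \<ge> 2 * (card (carrier D) - 1)"
  shows
    "(\<forall>F. F \<subseteq> wr_carrier D \<and> finite F \<and> F \<noteq> {} \<and> card F \<le> card (Fn D n) \<longrightarrow>
        real (card (edge_boundary D F)) / real (card F)
          \<ge> real (card (outer_boundary D F)) / real (card F)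
      \<and> real (card (outer_boundary D F)) / real (card F)
          \<ge> real (card (outer_boundary D (Fn D n))) / real (card (Fn D n))
      \<and> real (card (outer_boundary D (Fn D n))) / real (card (Fn D n))
          = real (card (edge_boundary D (Fn D n))) / real (card (Fn D n))
      \<and> (card F < card (Fn D n) \<longrightarrow>
          real (card (outer_boundary D F)) / real (card F)
            > real (card (outer_boundary D (Fn D n))) / real (card (Fn D n)))
      \<and> (real (card (outer_boundary D F)) / real (card F)
            = real (card (outer_boundary D (Fn D n))) / real (card (Fn D n))
          \<longleftrightarrow> (\<exists>g \<in> wr_carrier D. F = wr_mult D g ` Fn D n)))
   \<and> Fn D n \<union> outer_boundary D (Fn D n)
       = {(k, f) \<in> wr_carrier D. k \<in> {0..int n + 1} \<and> supp D f \<subseteq> {1..int n}}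
   \<and> (\<forall>F. F \<subseteq> wr_carrier D \<and> finite F \<and> F \<noteq> {}
          \<and> card F \<le> card (Fn D n \<union> outer_boundary D (Fn D n)) \<longrightarrow>
        real (card (inner_boundary D F)) / real (card F)
          \<ge> real (card (inner_boundary D (Fn D n \<union> outer_boundary D (Fn D n))))
             / real (card (Fn D n \<union> outer_boundary D (Fn D n)))
      \<and> (card F < card (Fn D n \<union> outer_boundary D (Fn D n)) \<longrightarrow>
          real (card (inner_boundary D F)) / real (card F)
            > real (card (inner_boundary D (Fn D n \<union> outer_boundary D (Fn D n))))
               / real (card (Fn D n \<union> outer_boundary D (Fn D n))))
      \<and> (real (card (inner_boundary D F)) / real (card F)
            = real (card (inner_boundary D (Fn D n \<union> outer_boundary D (Fn D n))))
               / real (card (Fn D n \<union> outer_boundary D (Fn D n)))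
          \<longleftrightarrow> (\<exists>g \<in> wr_carrier D. F = wr_mult D g ` (Fn D n \<union> outer_boundary D (Fn D n)))))"
proof -
  interpret finite_group D using assms(1,2) by (simp add: finite_group_def finite_group_axioms_def)
  note n = assms(3,4)
  let ?U = "Fn D n \<union> outer_boundary D (Fn D n)"
  have c: "card (carrier D) ^ n > 0" using card_carrier_pos by simp
  have r1: "real (card (outer_boundary D (Fn D n))) / real (card (Fn D n)) = 2 / real n"
    using c by (simp add: card_Fn card_outer_boundary_Fn[OF n(1)])
  have r2: "real (card (inner_boundary D ?U)) / real (card ?U) = 2 / real (n + 2)"
    unfolding inner_boundary_Fn_Un_outer_boundary[OF n(1)] card_Fn_Un_outer_boundary[OF n(1)]
      card_outer_boundary_Fn[OF n(1)] of_nat_mult using c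
    by (subst mult_divide_mult_cancel_right) auto
  have e: "card (edge_boundary D (Fn D n)) = card (outer_boundary D (Fn D n))"
    by (simp add: card_edge_boundary_Fn[OF n(1)] card_outer_boundary_Fn[OF n(1)])
  have set: "?U = {(k, f) \<in> wr_carrier D. k \<in> {0..int n + 1} \<and> supp D f \<subseteq> {1..int n}}"
    unfolding Fn_Un_outer_boundary[OF n(1)] by (auto simp: wr_carrier_def mem_subcube_one_iff subset_iff)
  show ?thesis
  proof (intro conjI allI impI set; (elim conjE)?)
    fix F :: "(int \<times> (int \<Rightarrow> 'a)) set"
    assume F: "F \<subseteq> wr_carrier D" "finite F" "F \<noteq> {}"
    have F0: "card F > 0" using F by (simp add: card_gt_0_iff)
    have n0: "n > 0" "n + 2 > 0" using n by auto
    show "real (card (edge_boundary D F)) / real (card F) \<ge> real (card (outer_boundary D F)) / real (card F)"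
      using card_outer_boundary_le_edge_boundary[OF F(2)] by (simp add: divide_right_mono)
    show "real (card (outer_boundary D (Fn D n))) / real (card (Fn D n))
          = real (card (edge_boundary D (Fn D n))) / real (card (Fn D n))"
      by (simp add: e)
    {
      assume le: "card F \<le> card (Fn D n)"
      note iso = outer_boundary_isoperimetry[OF n F le]
      show ge: "real (card (outer_boundary D F)) / real (card F)
          \<ge> real (card (outer_boundary D (Fn D n))) / real (card (Fn D n))"
        unfolding r1 two_div_le_iff(1)[OF F0 n0(1)] by (rule iso(1))
      show eq: "real (card (outer_boundary D F)) / real (card F)
            = real (card (outer_boundary D (Fn D n))) / real (card (Fn D n))
          \<longleftrightarrow> (\<exists>g \<in> wr_carrier D. F = wr_mult D g ` Fn D n)"
        unfolding r1 two_div_le_iff(2)[OF F0 n0(1)] by (rule iso(2))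
      \<comment> \<open>Translates of \<open>Fn D n\<close> have its cardinality, so a smaller set
        cannot attain equality.\<close>
      assume "card F < card (Fn D n)"
      then have "\<not> (\<exists>g \<in> wr_carrier D. F = wr_mult D g ` Fn D n)"
        using card_translate[OF _ Fn_carrier] by auto
      then show "real (card (outer_boundary D F)) / real (card F)
            > real (card (outer_boundary D (Fn D n))) / real (card (Fn D n))"
        using ge eq by linarith
    }
    {
      assume le: "card F \<le> card ?U"
      note iso = inner_boundary_isoperimetry[OF n F le]
      show ge: "real (card (inner_boundary D F)) / real (card F)
          \<ge> real (card (inner_boundary D ?U)) / real (card ?U)"
        unfolding r2 two_div_le_iff(1)[OF F0 n0(2)] by (rule iso(1))
      show eq: "real (card (inner_boundary D F)) / real (card F)
            = real (card (inner_boundary D ?U)) / real (card ?U)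
          \<longleftrightarrow> (\<exists>g \<in> wr_carrier D. F = wr_mult D g ` ?U)"
        unfolding r2 two_div_le_iff(2)[OF F0 n0(2)] by (rule iso(2))
      assume "card F < card ?U"
      then have "\<not> (\<exists>g \<in> wr_carrier D. F = wr_mult D g ` ?U)"
        using card_translate[OF _ Fn_Un_outer_boundary_carrier] by auto
      then show "real (card (inner_boundary D F)) / real (card F)
            > real (card (inner_boundary D ?U)) / real (card ?U)"
        using ge eq by linarith
    }
  qed
qed

end
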